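(* Each finite idempotent ordered monoid $\mathbf{M}$ is isomorphic to a unique nested sum $\boxplus_{i=1}^{n}\mathbf{M}_i$ (with $n\ge 0$) of algebras $\mathbf{M}_i\in\{\mathbf{C}_2,\mathbf{C}_2^\partial,\mathbf{G}_3,\mathbf{D}_3\}$; that is, there are a unique $n\ge 0$ and a unique sequence $(\mathbf{M}_1,\dots,\mathbf{M}_n)$ of members of $\{\mathbf{C}_2,\mathbf{C}_2^\partial,\mathbf{G}_3,\mathbf{D}_3\}$ such that $\mathbf{M}\cong\boxplus_{i=1}^{n}\mathbf{M}_i$.
   Context: An ordered monoid is a structure $\mathbf{M}=\langle M,\cdot,e,\le\rangle$ where $\langle M,\cdot,e\rangle$ is a monoid, $\le$ is a total order on $M$, and $a\le b$ implies $cad\le cbd$ for all $a,b,c,d\in M$. It is idempotent if $a\cdot a=a$ for all $a$. Isomorphisms are order-preserving monoid isomorphisms. The four algebras are the following idempotent ordered monoids with identity $e$: $\mathbf{C}_2$ has universe $\{\bot<e\}$ (so $\bot\cdot\bot=\bot$); $\mathbf{C}_2^\partial$ has universe $\{e<\top\}$ (so $\top\cdot\top=\top$); $\mathbf{G}_3$ has universe $\{\bot<e<\top\}$ with $\bot\cdot\bot=\bot\cdot\top=\bot$ and $\top\cdot\top=\top\cdot\bot=\top$; $\mathbf{D}_3$ has universe $\{\bot<e<\top\}$ with $\bot\cdot\bot=\top\cdot\bot=\bot$ and $\top\cdot\top=\bot\cdot\top=\top$. Nested sum: for idempotent ordered monoids $\mathbf{M},\mathbf{N}$, relabeled so that $M\cap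 N=\{e\}$, $\mathbf{M}\boxplus\mathbf{N}$ has universe $M\cup N$ and identity $e$; its product extends the products of $\mathbf{M}$ and $\mathbf{N}$, with $a\cdot b=b\cdot a=a$ for all $a\in M\setminus\{e\}$, $b\in N$; its order is the least extension of the orders of $\mathbf{M}$ and $\mathbf{N}$ such that for all $a\in M\setminus\{e\}$ and $b\in N$: $a\le b$ if $a\le_{\mathbf{M}}e$, and $b\le a$ if $e\le_{\mathbf{M}}a$. This is an idempotent ordered monoid and the operation is associative up to isomorphism. One writes $\boxplus_{i=1}^n\mathbf{M}_i=\mathbf{M}_1\boxplus\cdots\boxplus\mathbf{M}_n$, and $\boxplus_{i=1}^0\mathbf{M}_i=\mathbf{0}$ is the trivial (one-element) ordered monoid. *)

theory Defs
  imports "HOL-Algebra.Group" "HOL-Library.Countable"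
begin

record 'a omonoid = "'a monoid" +
  leq :: "'a \<Rightarrow> 'a \<Rightarrow> bool" (infix "\<preceq>\<index>" 50)

locale ordered_monoid = monoid M for M (structure) +
  assumes leq_refl: "reflp_on (carrier M) (\<preceq>)"
    and leq_trans: "transp_on (carrier M) (\<preceq>)"
    and leq_antisym: "antisymp_on (carrier M) (\<preceq>)"
    and leq_total: "totalp_on (carrier M) (\<preceq>)"
    and leq_mult: "\<lbrakk>a \<in> carrier M; b \<in> carrier M; c \<in> carrier M; d \<in> carrier M; a \<preceq> b\<rbrakk>
      \<Longrightarrow> c \<otimes> a \<otimes> d \<preceq> c \<otimes> b \<otimes> d"

locale idempotent_ordered_monoid = ordered_monoid +
  assumes idem: "a \<in> carrier M \<Longrightarrow> a \<otimes> a = a"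

definition omonoid_iso :: "('a, 'm) omonoid_scheme \<Rightarrow> ('b, 'n) omonoid_scheme \<Rightarrow> ('a \<Rightarrow> 'b) set" where
  "omonoid_iso M N = {f \<in> iso M N. f \<one>\<^bsub>M\<^esub> = \<one>\<^bsub>N\<^esub> \<and>
     (\<forall>a\<in>carrier M. \<forall>b\<in>carrier M. a \<preceq>\<^bsub>M\<^esub> b \<longleftrightarrow> f a \<preceq>\<^bsub>N\<^esub> f b)}"

definition omonoid_isomorphic :: "('a, 'm) omonoid_scheme \<Rightarrow> ('b, 'n) omonoid_scheme \<Rightarrow> bool"
    (infix "\<cong>\<^sub>o" 60) where
  "M \<cong>\<^sub>o N \<longleftrightarrow> omonoid_iso M N \<noteq> {}"

text \<open>
  The four algebras are realised on the integers with their usual order, reading \<open>-1\<close> as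
  \<open>\<bottom>\<close>, \<open>0\<close> as the identity \<open>e\<close> and \<open>1\<close> as \<open>\<top>\<close>. Among the non-identity elements the product of
  \<open>G3\<close> is the left projection and that of \<open>D3\<close> the right projection.
\<close>

definition C2 :: "int omonoid" where
  "C2 = \<lparr>carrier = {-1, 0}, mult = min, one = 0, leq = (\<le>)\<rparr>"

definition C2_dual :: "int omonoid" where
  "C2_dual = \<lparr>carrier = {0, 1}, mult = max, one = 0, leq = (\<le>)\<rparr>"

definition G3 :: "int omonoid" where
  "G3 = \<lparr>carrier = {-1, 0, 1}, mult = (\<lambda>x y. if x = 0 then y else x), one = 0, leq = (\<le>)\<rparr>"

definition D3 :: "int omonoid" where
  "D3 = \<lparr>carrier = {-1, 0, 1}, mult = (\<lambda>x y. if y = 0 then x else y), one = 0, leq = (\<le>)\<rparr>"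

text \<open>
  The nested sum of \<open>M\<close> and \<open>N\<close> lives on the sum type; the relabelling that makes the
  universes meet exactly in the identity sends \<open>N\<close> along \<^const>\<open>Inr\<close> and \<open>M\<close> along
  \<open>nested_left M N\<close>, which identifies the two identities.
\<close>

definition nested_left :: "('a, 'm) omonoid_scheme \<Rightarrow> ('b, 'n) omonoid_scheme \<Rightarrow> 'a \<Rightarrow> 'a + 'b" where
  "nested_left M N a = (if a = \<one>\<^bsub>M\<^esub> then Inr \<one>\<^bsub>N\<^esub> else Inl a)"

fun nested_mult :: "('a, 'm) omonoid_scheme \<Rightarrow> ('b, 'n) omonoid_scheme \<Rightarrow> 'a + 'b \<Rightarrow> 'a + 'b \<Rightarrow> 'a + 'b" where
  "nested_mult M N (Inl a) (Inl a') = nested_left M N (a \<otimes>\<^bsub>M\<^esub> a')"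
| "nested_mult M N (Inl a) (Inr b) = Inl a"
| "nested_mult M N (Inr b) (Inl a) = Inl a"
| "nested_mult M N (Inr b) (Inr b') = Inr (b \<otimes>\<^bsub>N\<^esub> b')"

text \<open>The least relation with these closure properties is already transitive when \<open>M\<close> and \<open>N\<close>
  are ordered monoids, hence it is the least order with them.\<close>

inductive nested_leq :: "('a, 'm) omonoid_scheme \<Rightarrow> ('b, 'n) omonoid_scheme \<Rightarrow> 'a + 'b \<Rightarrow> 'a + 'b \<Rightarrow> bool"
  for M N where
  left: "\<lbrakk>a \<in> carrier M; a' \<in> carrier M; a \<preceq>\<^bsub>M\<^esub> a'\<rbrakk>
    \<Longrightarrow> nested_leq M N (nested_left M N a) (nested_left M N a')"
| right: "\<lbrakk>b \<in> carrier N; b' \<in> carrier N; b \<preceq>\<^bsub>N\<^esub> b'\<rbrakk> \<Longrightarrow> nested_leq M N (Inr b) (Inr b')"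
| below: "\<lbrakk>a \<in> carrier M - {\<one>\<^bsub>M\<^esub>}; b \<in> carrier N; a \<preceq>\<^bsub>M\<^esub> \<one>\<^bsub>M\<^esub>\<rbrakk> \<Longrightarrow> nested_leq M N (Inl a) (Inr b)"
| above: "\<lbrakk>a \<in> carrier M - {\<one>\<^bsub>M\<^esub>}; b \<in> carrier N; \<one>\<^bsub>M\<^esub> \<preceq>\<^bsub>M\<^esub> a\<rbrakk> \<Longrightarrow> nested_leq M N (Inr b) (Inl a)"

definition nested_sum :: "('a, 'm) omonoid_scheme \<Rightarrow> ('b, 'n) omonoid_scheme \<Rightarrow> ('a + 'b) omonoid"
    (infixr "\<boxplus>" 65) where
  "M \<boxplus> N = \<lparr>carrier = nested_left M N ` carrier M \<union> Inr ` carrier N,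
     mult = nested_mult M N, one = Inr \<one>\<^bsub>N\<^esub>, leq = nested_leq M N\<rparr>"

text \<open>Transport of the structure along \<open>f\<close>, which is meant to be injective on the carrier.\<close>

definition relabel :: "('a \<Rightarrow> 'b) \<Rightarrow> ('a, 'm) omonoid_scheme \<Rightarrow> 'b omonoid" where
  "relabel f M = (let g = inv_into (carrier M) f in
     \<lparr>carrier = f ` carrier M, mult = (\<lambda>x y. f (g x \<otimes>\<^bsub>M\<^esub> g y)), one = f \<one>\<^bsub>M\<^esub>,
      leq = (\<lambda>x y. g x \<preceq>\<^bsub>M\<^esub> g y)\<rparr>)"

definition trivial_omonoid :: "nat omonoid" where
  "trivial_omonoid = \<lparr>carrier = {0}, mult = (\<lambda>_ _. 0), one = 0, leq = (\<le>)\<rparr>"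

text \<open>The universe of each partial sum is encoded into \<^typ>\<open>nat\<close>, so that sums of any length have
  the same type. The sum is bracketed to the right and ends in the trivial ordered monoid, which is
  neutral up to isomorphism.\<close>

fun nested_sum_list :: "('a::countable) omonoid list \<Rightarrow> nat omonoid" where
  "nested_sum_list [] = trivial_omonoid"
| "nested_sum_list (M # Ms) = relabel to_nat (M \<boxplus> nested_sum_list Ms)"

end

theory Submission
  imports Defs
begin

text \<open>
  The outermost summand of a nested sum can be read off from the multiplication alone. Call the
  set of all \<open>s\<close> with \<open>s \<otimes> x \<otimes> s = s\<close> for every \<open>x\<close> the minimal ideal. (In a finite idempotent
  monoid this is the least nonempty two-sided ideal.) In \<open>K \<boxplus> N\<close>, with \<open>K\<close> one of the four
  algebras, the non-identity elements of \<open>K\<close> absorb \<open>N\<close> and multiply among themselves by a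
  projection, so they form exactly the minimal ideal. Since isomorphisms preserve the minimal
  ideal \<open>I\<close>, an isomorphism from \<open>M\<close> to \<open>K \<boxplus> N\<close> restricts to isomorphisms \<open>I \<union> {\<one>} \<cong> K\<close> and
  \<open>M - I \<cong> N\<close>. Hence \<open>K\<close> and, up to isomorphism, \<open>N\<close> are determined by \<open>M\<close>.

  Conversely, every nontrivial finite idempotent ordered monoid splits along its minimal ideal.
  The order forces a product of two elements to be one of its factors
  (lemma \<open>mult_conservative\<close>). So a product of \<open>s \<in> I\<close> with \<open>x \<notin> I\<close>, which lies in the ideal
  \<open>I\<close>, must be \<open>s\<close>, and \<open>M - I\<close> is closed under multiplication. The order between the two parts
  is then forced as well. Finally, comparable elements on the same side of \<open>\<one>\<close> commute, whereas
  \<open>a \<otimes> b \<otimes> a = a\<close> in \<open>I\<close>. So \<open>I\<close> has at most one element below and at most one above \<open>\<one>\<close>,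
  which leaves only the four algebras for \<open>I \<union> {\<one>}\<close>.

  These two directions together are lemma \<open>isomorphic_nested_sum_iff\<close>, and the theorem follows by
  induction on the number of elements.
\<close>

section \<open>Isomorphisms\<close>

lemma omonoid_iso_iff:
  "f \<in> omonoid_iso M N \<longleftrightarrow> bij_betw f (carrier M) (carrier N) \<and> f \<one>\<^bsub>M\<^esub> = \<one>\<^bsub>N\<^esub> \<and>
     (\<forall>a\<in>carrier M. \<forall>b\<in>carrier M. f (a \<otimes>\<^bsub>M\<^esub> b) = f a \<otimes>\<^bsub>N\<^esub> f b) \<and>
     (\<forall>a\<in>carrier M. \<forall>b\<in>carrier M. a \<preceq>\<^bsub>M\<^esub> b \<longleftrightarrow> f a \<preceq>\<^bsub>N\<^esub> f b)"
  by (auto simp: omonoid_iso_def iso_def hom_def bij_betw_def)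

lemma omonoid_isoI:
  assumes "bij_betw f (carrier M) (carrier N)" and "f \<one>\<^bsub>M\<^esub> = \<one>\<^bsub>N\<^esub>"
    and "\<And>a b. \<lbrakk>a \<in> carrier M; b \<in> carrier M\<rbrakk> \<Longrightarrow> f (a \<otimes>\<^bsub>M\<^esub> b) = f a \<otimes>\<^bsub>N\<^esub> f b"
    and "\<And>a b. \<lbrakk>a \<in> carrier M; b \<in> carrier M\<rbrakk> \<Longrightarrow> a \<preceq>\<^bsub>M\<^esub> b \<longleftrightarrow> f a \<preceq>\<^bsub>N\<^esub> f b"
  shows "f \<in> omonoid_iso M N"
  using assms by (simp add: omonoid_iso_iff)

lemma omonoid_isoD:
  assumes "f \<in> omonoid_iso M N"
  shows "bij_betw f (carrier M) (carrier N)" and "f \<one>\<^bsub>M\<^esub> = \<one>\<^bsub>N\<^esub>"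
    and "\<And>a b. \<lbrakk>a \<in> carrier M; b \<in> carrier M\<rbrakk> \<Longrightarrow> f (a \<otimes>\<^bsub>M\<^esub> b) = f a \<otimes>\<^bsub>N\<^esub> f b"
    and "\<And>a b. \<lbrakk>a \<in> carrier M; b \<in> carrier M\<rbrakk> \<Longrightarrow> a \<preceq>\<^bsub>M\<^esub> b \<longleftrightarrow> f a \<preceq>\<^bsub>N\<^esub> f b"
  using assms by (simp_all add: omonoid_iso_iff)

lemma isomorphic_relabel_iff:
  fixes M :: "('a, 'm) omonoid_scheme" and P :: "('b, 'n) omonoid_scheme"
  assumes M: "monoid M" and f: "inj f"
  shows "M \<cong>\<^sub>o relabel f P \<longleftrightarrow> M \<cong>\<^sub>o P"
proof
  assume "M \<cong>\<^sub>o relabel f P"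
  then obtain h where h: "h \<in> omonoid_iso M (relabel f P)"
    by (auto simp: omonoid_isomorphic_def)
  note h' = omonoid_isoD[OF h, unfolded relabel_def Let_def, simplified]
  define p where "p = inv_into (carrier P) f \<circ> h"
  have inv: "inv_into (carrier P) f (f z) = z" if "z \<in> carrier P" for z
    using that f by (simp add: inv_into_f_f inj_on_subset[OF f])
  have p: "p x \<in> carrier P" "f (p x) = h x" if "x \<in> carrier M" for x
    using that bij_betwE[OF h'(1)] inv by (auto simp: p_def)
  have "p \<in> omonoid_iso M P"
  proof (rule omonoid_isoI)
    have "bij_betw (inv_into (carrier P) f) (f ` carrier P) (carrier P)"
      using f by (intro bij_betw_inv_into) (auto simp: bij_betw_def inj_on_def)
    then show "bij_betw p (carrier M) (carrier P)"
      unfolding p_def using h'(1) by (rule bij_betw_trans[rotated])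
    have "f \<one>\<^bsub>P\<^esub> \<in> f ` carrier P"
      using h'(2) bij_betwE[OF h'(1)] monoid.one_closed[OF M] by metis
    then have "\<one>\<^bsub>P\<^esub> \<in> carrier P"
      using f by (simp add: inj_image_mem_iff)
    then show "p \<one>\<^bsub>M\<^esub> = \<one>\<^bsub>P\<^esub>"
      using h'(2) inv by (simp add: p_def)
  next
    fix a b assume ab: "a \<in> carrier M" "b \<in> carrier M"
    have eq: "f (p (a \<otimes>\<^bsub>M\<^esub> b)) = f (p a \<otimes>\<^bsub>P\<^esub> p b)"
      using h'(3)[OF ab] p(2)[OF monoid.m_closed[OF M ab]] by (simp add: p_def)
    then show "p (a \<otimes>\<^bsub>M\<^esub> b) = p a \<otimes>\<^bsub>P\<^esub> p b"
      using f by (simp add: inj_eq)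
    show "a \<preceq>\<^bsub>M\<^esub> b \<longleftrightarrow> p a \<preceq>\<^bsub>P\<^esub> p b"
      using h'(4)[OF ab] by (simp add: p_def)
  qed
  then show "M \<cong>\<^sub>o P"
    by (auto simp: omonoid_isomorphic_def)
next
  assume "M \<cong>\<^sub>o P"
  then obtain g where g: "g \<in> omonoid_iso M P"
    by (auto simp: omonoid_isomorphic_def)
  note g' = omonoid_isoD[OF g]
  have inv: "inv_into (carrier P) f (f (g x)) = g x" if "x \<in> carrier M" for x
    using that f bij_betwE[OF g'(1)] by (simp add: inv_into_f_f inj_on_subset[OF f])
  have "f \<circ> g \<in> omonoid_iso M (relabel f P)"
  proof (rule omonoid_isoI)
    have "bij_betw f (carrier P) (f ` carrier P)"
      using f by (auto simp: bij_betw_def inj_on_def)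
    then show "bij_betw (f \<circ> g) (carrier M) (carrier (relabel f P))"
      using g'(1) by (simp add: relabel_def Let_def bij_betw_trans)
  qed (use g' inv in \<open>auto simp: relabel_def Let_def\<close>)
  then show "M \<cong>\<^sub>o relabel f P"
    by (auto simp: omonoid_isomorphic_def)
qed

section \<open>The minimal ideal of an idempotent ordered monoid\<close>

text \<open>
  In an idempotent monoid with a least nonempty two-sided ideal, these are its elements: \<open>s\<close> lies
  in every nonempty ideal \<open>J\<close>, as \<open>s = s \<otimes> x \<otimes> s\<close> for any \<open>x \<in> J\<close>.
\<close>
definition minimal_ideal :: "('a, 'm) omonoid_scheme \<Rightarrow> 'a set" where
  "minimal_ideal M = {s \<in> carrier M. \<forall>x\<in>carrier M. s \<otimes>\<^bsub>M\<^esub> x \<otimes>\<^bsub>M\<^esub> s = s}"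

text \<open>
  The two parts keep the type of \<open>M\<close>, which allows an induction that replaces \<open>M\<close> by its inner part.
\<close>
abbreviation outer_layer :: "('a, 'm) omonoid_scheme \<Rightarrow> ('a, 'm) omonoid_scheme" where
  "outer_layer M \<equiv> M\<lparr>carrier := insert \<one>\<^bsub>M\<^esub> (minimal_ideal M)\<rparr>"

abbreviation inner_part :: "('a, 'm) omonoid_scheme \<Rightarrow> ('a, 'm) omonoid_scheme" where
  "inner_part M \<equiv> M\<lparr>carrier := carrier M - minimal_ideal M\<rparr>"

lemma minimal_ideal_subset: "minimal_ideal M \<subseteq> carrier M"
  by (auto simp: minimal_ideal_def)

context idempotent_ordered_monoid
begin

lemma refl_leq: "a \<in> carrier M \<Longrightarrow> a \<preceq> a"
  by (rule reflp_onD[OF leq_refl])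

lemma trans_leq: "\<lbrakk>a \<preceq> b; b \<preceq> c; a \<in> carrier M; b \<in> carrier M; c \<in> carrier M\<rbrakk> \<Longrightarrow> a \<preceq> c"
  by (rule transp_onD[OF leq_trans])

lemma antisym_leq: "\<lbrakk>a \<preceq> b; b \<preceq> a; a \<in> carrier M; b \<in> carrier M\<rbrakk> \<Longrightarrow> a = b"
  by (rule antisymp_onD[OF leq_antisym])

lemma total_leq: "\<lbrakk>a \<in> carrier M; b \<in> carrier M\<rbrakk> \<Longrightarrow> a \<preceq> b \<or> b \<preceq> a"
  using totalp_onD[OF leq_total] refl_leq by blast

lemma mult_left_mono:
  "\<lbrakk>a \<preceq> b; a \<in> carrier M; b \<in> carrier M; c \<in> carrier M\<rbrakk> \<Longrightarrow> c \<otimes> a \<preceq> c \<otimes> b"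
  using leq_mult[of a b c \<one>] by simp

lemma mult_right_mono:
  "\<lbrakk>a \<preceq> b; a \<in> carrier M; b \<in> carrier M; c \<in> carrier M\<rbrakk> \<Longrightarrow> a \<otimes> c \<preceq> b \<otimes> c"
  using leq_mult[of a b \<one> c] by simp

lemma mult_below_one:
  assumes "a \<preceq> b" "b \<preceq> \<one>" "a \<in> carrier M" "b \<in> carrier M"
  shows "a \<otimes> b = a" and "b \<otimes> a = a"
  using mult_left_mono[of a b a] mult_right_mono[of a b a] mult_left_mono[of b \<one> a]
    mult_right_mono[of b \<one> a] assms idem[of a] by (auto intro: antisym_leq)

lemma mult_above_one:
  assumes "a \<preceq> b" "\<one> \<preceq> a" "a \<in> carrier M" "b \<in> carrier M"
  shows "a \<otimes> b = b" and "b \<otimes> a = b"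
  using mult_left_mono[of a b b] mult_right_mono[of a b b] mult_left_mono[of \<one> a b]
    mult_right_mono[of \<one> a b] assms idem[of b] by (auto intro: antisym_leq)

text \<open>
  For \<open>a \<preceq> \<one> \<preceq> b\<close> the product is above \<open>a\<close> and below \<open>b\<close>. If it is itself below \<open>\<one>\<close>, then
  \<open>a \<otimes> b = a \<otimes> (a \<otimes> b) \<preceq> a\<close>. If it is above \<open>\<one>\<close>, then \<open>b \<preceq> (a \<otimes> b) \<otimes> b = a \<otimes> b\<close>.
\<close>
lemma mult_opposite_sides:
  assumes "a \<preceq> \<one>" "\<one> \<preceq> b" and ab: "a \<in> carrier M" "b \<in> carrier M"
  shows "a \<otimes> b = a \<or> a \<otimes> b = b" and "b \<otimes> a = a \<or> b \<otimes> a = b"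
proof -
  have c: "a \<otimes> b \<in> carrier M" "b \<otimes> a \<in> carrier M"
    using ab by auto
  have idems: "a \<otimes> (a \<otimes> b) = a \<otimes> b" "(a \<otimes> b) \<otimes> b = a \<otimes> b"
    "(b \<otimes> a) \<otimes> a = b \<otimes> a" "b \<otimes> (b \<otimes> a) = b \<otimes> a"
    using ab idem[of a] idem[of b] m_assoc[of a a b] m_assoc[of a b b] m_assoc[of b a a]
      m_assoc[of b b a] by auto
  have between: "a \<preceq> a \<otimes> b" "a \<preceq> b \<otimes> a" "a \<otimes> b \<preceq> b" "b \<otimes> a \<preceq> b"
    using assms mult_left_mono[of \<one> b a] mult_right_mono[of \<one> b a]
      mult_left_mono[of a \<one> b] mult_right_mono[of a \<one> b] by auto
  show "a \<otimes> b = a \<or> a \<otimes> b = b"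
    using total_leq[OF c(1) one_closed]
  proof
    assume "a \<otimes> b \<preceq> \<one>"
    then have "a \<otimes> b \<preceq> a"
      using mult_left_mono[of "a \<otimes> b" \<one> a] c ab idems by simp
    then show ?thesis
      using between c ab antisym_leq by auto
  next
    assume "\<one> \<preceq> a \<otimes> b"
    then have "b \<preceq> a \<otimes> b"
      using mult_right_mono[of \<one> "a \<otimes> b" b] c ab idems by simp
    then show ?thesis
      using between c ab antisym_leq by auto
  qed
  show "b \<otimes> a = a \<or> b \<otimes> a = b"
    using total_leq[OF c(2) one_closed]
  proof
    assume "b \<otimes> a \<preceq> \<one>"
    then have "b \<otimes> a \<preceq> a"
      using mult_right_mono[of "b \<otimes> a" \<one> a] c ab idems by simp
    then show ?thesis
      using between c ab antisym_leq by auto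
  next
    assume "\<one> \<preceq> b \<otimes> a"
    then have "b \<preceq> b \<otimes> a"
      using mult_left_mono[of \<one> "b \<otimes> a" b] c ab idems by simp
    then show ?thesis
      using between c ab antisym_leq by auto
  qed
qed

lemma mult_conservative:
  assumes "a \<in> carrier M" "b \<in> carrier M"
  shows "a \<otimes> b = a \<or> a \<otimes> b = b"
  using total_leq[OF assms] total_leq[OF assms(1) one_closed] total_leq[OF assms(2) one_closed]
    mult_below_one[of a b] mult_below_one[of b a] mult_above_one[of a b] mult_above_one[of b a]
    mult_opposite_sides[of a b] mult_opposite_sides[of b a] assms
  by blast

lemma minimal_idealD:
  "\<lbrakk>s \<in> minimal_ideal M; x \<in> carrier M\<rbrakk> \<Longrightarrow> s \<otimes> x \<otimes> s = s"
  "s \<in> minimal_ideal M \<Longrightarrow> s \<in> carrier M"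
  by (auto simp: minimal_ideal_def)

lemma minimal_ideal_is_ideal:
  assumes s: "s \<in> minimal_ideal M" and x: "x \<in> carrier M"
  shows "s \<otimes> x \<in> minimal_ideal M" and "x \<otimes> s \<in> minimal_ideal M"
proof -
  have sc: "s \<in> carrier M"
    using s by (rule minimal_idealD)
  have "s \<otimes> x \<otimes> y \<otimes> (s \<otimes> x) = s \<otimes> x" if y: "y \<in> carrier M" for y
  proof -
    have "s \<otimes> x \<otimes> y \<otimes> (s \<otimes> x) = s \<otimes> (x \<otimes> y) \<otimes> s \<otimes> x"
      using sc x y by (simp add: m_assoc)
    then show ?thesis
      using minimal_idealD(1)[OF s, of "x \<otimes> y"] x y by simp
  qed
  then show "s \<otimes> x \<in> minimal_ideal M"
    using sc x by (auto simp: minimal_ideal_def)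
  have "x \<otimes> s \<otimes> y \<otimes> (x \<otimes> s) = x \<otimes> s" if y: "y \<in> carrier M" for y
  proof -
    have "x \<otimes> s \<otimes> y \<otimes> (x \<otimes> s) = x \<otimes> (s \<otimes> (y \<otimes> x) \<otimes> s)"
      using sc x y by (simp add: m_assoc)
    then show ?thesis
      using minimal_idealD(1)[OF s, of "y \<otimes> x"] x y by simp
  qed
  then show "x \<otimes> s \<in> minimal_ideal M"
    using sc x by (auto simp: minimal_ideal_def)
qed

lemma minimal_ideal_absorbs:
  assumes "s \<in> minimal_ideal M" "x \<in> carrier M" "x \<notin> minimal_ideal M"
  shows "s \<otimes> x = s" and "x \<otimes> s = s"
  using minimal_ideal_is_ideal[OF assms(1,2)] assms minimal_idealD(2)
    mult_conservative[of s x] mult_conservative[of x s] by auto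

text \<open>
  If \<open>x\<close> lay beyond \<open>s\<close> as seen from \<open>\<one>\<close>, then \<open>x \<otimes> s\<close> would be \<open>x\<close>. But \<open>s\<close> absorbs \<open>x\<close>.
\<close>
lemma minimal_ideal_leq_iff:
  assumes s: "s \<in> minimal_ideal M" and x: "x \<in> carrier M" "x \<notin> minimal_ideal M"
  shows "s \<preceq> x \<longleftrightarrow> s \<preceq> \<one>" and "x \<preceq> s \<longleftrightarrow> \<one> \<preceq> s"
proof -
  have sc: "s \<in> carrier M"
    using s by (rule minimal_idealD)
  have neq: "s \<noteq> x"
    using s x by auto
  have absorb: "x \<otimes> s = s"
    by (rule minimal_ideal_absorbs) (fact assms)+
  have below: "s \<preceq> x" if "s \<preceq> \<one>"
    using total_leq[OF sc x(1)] mult_below_one(1)[of x s] that absorb neq sc x(1) by auto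
  have above: "x \<preceq> s" if "\<one> \<preceq> s"
    using total_leq[OF sc x(1)] mult_above_one(2)[of s x] that absorb neq sc x(1) by auto
  show "s \<preceq> x \<longleftrightarrow> s \<preceq> \<one>"
    using total_leq[OF sc one_closed] below above antisym_leq[OF _ _ sc x(1)] neq by blast
  show "x \<preceq> s \<longleftrightarrow> \<one> \<preceq> s"
    using total_leq[OF sc one_closed] below above antisym_leq[OF _ _ sc x(1)] neq by blast
qed

text \<open>
  Below, \<open>a\<close> is chosen minimal for the natural order of idempotents, where \<open>u\<close> is below \<open>a\<close> iff
  \<open>a \<otimes> u = u = u \<otimes> a\<close>. All elements \<open>a \<otimes> x \<otimes> a\<close> are below \<open>a\<close>, hence equal to it.
\<close>
lemma minimal_ideal_nonempty:
  assumes "finite (carrier M)"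
  shows "minimal_ideal M \<noteq> {}"
proof -
  define R where "R u v \<longleftrightarrow> u \<noteq> v \<and> v \<otimes> u = u \<and> u \<otimes> v = u" for u v
  have "asymp_on (carrier M) R"
    by (auto simp: asymp_on_def R_def)
  moreover have "transp_on (carrier M) R"
  proof (rule transp_onI)
    fix u v w
    assume c: "u \<in> carrier M" "v \<in> carrier M" "w \<in> carrier M" and "R u v" "R v w"
    then have eqs: "v \<otimes> u = u" "u \<otimes> v = u" "w \<otimes> v = v" "v \<otimes> w = v" "u \<noteq> v"
      by (auto simp: R_def)
    have "w \<otimes> u = u" "u \<otimes> w = u"
      using eqs c m_assoc[of w v u] m_assoc[of u v w] by auto
    moreover from this have "u \<noteq> w"
      using eqs by auto
    ultimately show "R u w"
      by (simp add: R_def)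
  qed
  ultimately obtain a where a: "a \<in> carrier M"
    and min: "\<And>x. \<lbrakk>x \<in> carrier M; x \<noteq> a\<rbrakk> \<Longrightarrow> \<not> R x a"
    using Finite_Set.bex_min_element[OF assms, of R] one_closed by blast
  have "a \<otimes> x \<otimes> a = a" if x: "x \<in> carrier M" for x
  proof -
    have "a \<otimes> (a \<otimes> x \<otimes> a) = a \<otimes> x \<otimes> a" "a \<otimes> x \<otimes> a \<otimes> a = a \<otimes> x \<otimes> a"
      using a x idem[OF a] m_assoc[of a a "x \<otimes> a"] m_assoc[of a x a] m_assoc[of "a \<otimes> x" a a]
      by auto
    then show ?thesis
      using min[of "a \<otimes> x \<otimes> a"] a x by (auto simp: R_def)
  qed
  then show ?thesis
    using a by (auto simp: minimal_ideal_def)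
qed

lemma one_in_minimal_ideal_iff: "\<one> \<in> minimal_ideal M \<longleftrightarrow> carrier M = {\<one>}"
  using idem by (auto simp: minimal_ideal_def)

text \<open>
  The complement of the minimal ideal is closed under multiplication because a product is one of
  its factors.
\<close>
lemma inner_part_idempotent_ordered_monoid:
  assumes "carrier M \<noteq> {\<one>}"
  shows "idempotent_ordered_monoid (inner_part M)"
proof
  show "\<one>\<^bsub>inner_part M\<^esub> \<in> carrier (inner_part M)"
    using assms one_in_minimal_ideal_iff by simp
  fix x y
  assume "x \<in> carrier (inner_part M)" "y \<in> carrier (inner_part M)"
  then show "x \<otimes>\<^bsub>inner_part M\<^esub> y \<in> carrier (inner_part M)"
    using mult_conservative[of x y] by auto
next
  show "reflp_on (carrier (inner_part M)) (\<preceq>\<^bsub>inner_part M\<^esub>)"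
    by (auto simp: reflp_on_def refl_leq)
  show "transp_on (carrier (inner_part M)) (\<preceq>\<^bsub>inner_part M\<^esub>)"
    by (rule transp_onI) (auto intro: trans_leq)
  show "antisymp_on (carrier (inner_part M)) (\<preceq>\<^bsub>inner_part M\<^esub>)"
    by (rule antisymp_onI) (auto intro: antisym_leq)
  show "totalp_on (carrier (inner_part M)) (\<preceq>\<^bsub>inner_part M\<^esub>)"
    by (rule totalp_onI) (auto dest: total_leq)
next
  fix a b c d
  assume "a \<in> carrier (inner_part M)" "b \<in> carrier (inner_part M)" "c \<in> carrier (inner_part M)"
    "d \<in> carrier (inner_part M)" "a \<preceq>\<^bsub>inner_part M\<^esub> b"
  then show "c \<otimes>\<^bsub>inner_part M\<^esub> a \<otimes>\<^bsub>inner_part M\<^esub> d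
      \<preceq>\<^bsub>inner_part M\<^esub> c \<otimes>\<^bsub>inner_part M\<^esub> b \<otimes>\<^bsub>inner_part M\<^esub> d"
    by (auto intro: leq_mult)
qed (auto intro: m_assoc idem)

text \<open>
  Two comparable elements on the same side of \<open>\<one>\<close> multiply to one of them in either order, so
  that \<open>a \<otimes> b \<otimes> a = a\<close> and \<open>b \<otimes> a \<otimes> b = b\<close> both give this element.
\<close>
lemma minimal_ideal_same_side:
  assumes a: "a \<in> minimal_ideal M" and b: "b \<in> minimal_ideal M"
    and side: "a \<preceq> \<one> \<and> b \<preceq> \<one> \<or> \<one> \<preceq> a \<and> \<one> \<preceq> b"
  shows "a = b"
proof -
  have c: "a \<in> carrier M" "b \<in> carrier M"
    using a b minimal_idealD by auto
  have "a \<otimes> b = b \<otimes> a"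
    using side total_leq[OF c] mult_below_one[of a b] mult_below_one[of b a]
      mult_above_one[of a b] mult_above_one[of b a] c by auto
  moreover have "a \<otimes> b \<otimes> a = a" "b \<otimes> a \<otimes> b = b"
    using minimal_idealD a b by auto
  ultimately show "a = b"
    using c idem m_assoc by metis
qed

section \<open>The outer layer is one of the four algebras\<close>

text \<open>
  The isomorphism records only the side of \<open>\<one>\<close> on which an element lies. It is injective and
  monotone because the minimal ideal has at most one element on each side, so that only the
  multiplication tables remain to be compared. Two elements \<open>s\<close> and \<open>t\<close> on opposite sides satisfy
  \<open>s \<otimes> t \<otimes> s = s\<close> and \<open>t \<otimes> s \<otimes> t = t\<close>, so the value of \<open>s \<otimes> t\<close> determines that of \<open>t \<otimes> s\<close>.
\<close>
lemma ex_outer_layer_isomorphic: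
  assumes fin: "finite (carrier M)" and nontrivial: "carrier M \<noteq> {\<one>}"
  shows "\<exists>K \<in> {C2, C2_dual, G3, D3}. outer_layer M \<cong>\<^sub>o K"
proof -
  define f :: "'a \<Rightarrow> int" where "f x = (if x = \<one> then 0 else if x \<preceq> \<one> then -1 else 1)" for x
  have no_one: "\<one> \<notin> minimal_ideal M"
    using nontrivial one_in_minimal_ideal_iff by simp
  have f_inj: "s = t" if "s \<in> minimal_ideal M" "t \<in> minimal_ideal M" "f s = f t" for s t
    using that no_one minimal_ideal_same_side[of s t] total_leq[of s \<one>] total_leq[of t \<one>]
      minimal_idealD(2)
    by (auto simp: f_def split: if_splits)
  have iso: "outer_layer M \<cong>\<^sub>o K"
    if "f ` insert \<one> (minimal_ideal M) = carrier K" and "one K = 0" and "leq K = (\<le>)"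
      and mult: "\<And>a b. \<lbrakk>a \<in> insert \<one> (minimal_ideal M); b \<in> insert \<one> (minimal_ideal M)\<rbrakk>
        \<Longrightarrow> f (a \<otimes> b) = f a \<otimes>\<^bsub>K\<^esub> f b"
    for K :: "int omonoid"
  proof -
    have sides: "a \<preceq> \<one> \<or> \<one> \<preceq> a" "a \<in> carrier M" if "a \<in> minimal_ideal M" for a
      using that total_leq minimal_idealD(2) by auto
    have "inj_on f (insert \<one> (minimal_ideal M))"
      using f_inj no_one by (auto simp: inj_on_def f_def split: if_splits)
    moreover have "a \<preceq> b \<longleftrightarrow> f a \<le> f b"
      if ab: "a \<in> insert \<one> (minimal_ideal M)" "b \<in> insert \<one> (minimal_ideal M)" for a b
    proof -
      have c: "a \<in> carrier M" "b \<in> carrier M"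
        using that minimal_idealD(2) by auto
      consider "a = b" | "a \<noteq> b" "a \<preceq> \<one>" "\<one> \<preceq> b" | "a \<noteq> b" "b \<preceq> \<one>" "\<one> \<preceq> a"
        using ab minimal_ideal_same_side[of a b] sides refl_leq[OF one_closed] by blast
      then show ?thesis
      proof cases
        case 1
        then show ?thesis
          using refl_leq c by simp
      next
        case 2
        then show ?thesis
          using trans_leq[of a \<one> b] antisym_leq[of b \<one>] c by (auto simp: f_def)
      next
        case 3
        then have "b \<preceq> a"
          using trans_leq[of b \<one> a] c by auto
        then have "\<not> a \<preceq> b"
          using 3 antisym_leq c by auto
        then show ?thesis
          using 3 antisym_leq[of a \<one>] antisym_leq[of b \<one>] c by (auto simp: f_def)
      qed
    qed
    ultimately have "f \<in> omonoid_iso (outer_layer M) K"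
      using that by (intro omonoid_isoI) (auto simp: bij_betw_def f_def)
    then show ?thesis
      by (auto simp: omonoid_isomorphic_def)
  qed
  have f_values: "f s = -1 \<or> f s = 1" if "s \<in> minimal_ideal M" for s
    using that no_one by (auto simp: f_def)
  have f_one: "f \<one> = 0"
    by (simp add: f_def)
  obtain s where s: "s \<in> minimal_ideal M"
    using minimal_ideal_nonempty[OF fin] by auto
  show ?thesis
  proof (cases "minimal_ideal M = {s}")
    case True
    have ss: "s \<otimes> s = s" "s \<in> carrier M"
      using s minimal_idealD idem by auto
    show ?thesis
    proof (cases "f s = -1")
      case below: True
      have "outer_layer M \<cong>\<^sub>o C2"
        using True ss below by (intro iso) (auto simp: C2_def f_one)
      then show ?thesis
        by simp
    next
      case False
      then have "f s = 1"
        using f_values s by auto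
      then have "outer_layer M \<cong>\<^sub>o C2_dual"
        using True ss by (intro iso) (auto simp: C2_dual_def f_one)
      then show ?thesis
        by simp
    qed
  next
    case False
    then obtain t where t: "t \<in> minimal_ideal M" "t \<noteq> s"
      using s by auto
    then have signs: "f s = - 1 \<and> f t = 1 \<or> f s = 1 \<and> f t = -1"
      using f_inj[of s t] f_values[OF s] f_values[OF t(1)] s by auto
    have "u = s \<or> u = t" if u: "u \<in> minimal_ideal M" for u
      using f_inj[OF u s] f_inj[OF u t(1)] f_values[OF u] signs by auto
    then have ideal: "minimal_ideal M = {s, t}"
      using s t by auto
    have c: "s \<in> carrier M" "t \<in> carrier M"
      using s t minimal_idealD by auto
    have squares: "s \<otimes> s = s" "t \<otimes> t = t"
      using c idem by auto
    have sandwich: "s \<otimes> t \<otimes> s = s" "t \<otimes> s \<otimes> t = t"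
      using s t c minimal_idealD by auto
    show ?thesis
      using mult_conservative[OF c]
    proof
      assume st: "s \<otimes> t = s"
      then have ts: "t \<otimes> s = t"
        using sandwich c by (simp add: m_assoc)
      have "outer_layer M \<cong>\<^sub>o G3"
        using ideal squares st ts signs c by (intro iso) (auto simp: G3_def f_one)
      then show ?thesis
        by simp
    next
      assume st: "s \<otimes> t = t"
      then have ts: "t \<otimes> s = s"
        using sandwich c by simp
      have "outer_layer M \<cong>\<^sub>o D3"
        using ideal squares st ts signs c by (intro iso) (auto simp: D3_def f_one)
      then show ?thesis
        by simp
    qed
  qed
qed

end

text \<open>
  The four algebras differ in three isomorphism invariants: whether there is an element below the
  identity, whether there is one above it, and whether the non-identity elements multiply by the
  left projection.
\<close>
lemma isomorphic_four_algebras_unique: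
  fixes L :: "('a, 'm) omonoid_scheme" and K K' :: "int omonoid"
  assumes one: "\<one>\<^bsub>L\<^esub> \<in> carrier L"
    and closed: "\<And>a b. \<lbrakk>a \<in> carrier L; b \<in> carrier L\<rbrakk> \<Longrightarrow> a \<otimes>\<^bsub>L\<^esub> b \<in> carrier L"
    and K: "K \<in> {C2, C2_dual, G3, D3}" "L \<cong>\<^sub>o K"
    and K': "K' \<in> {C2, C2_dual, G3, D3}" "L \<cong>\<^sub>o K'"
  shows "K = K'"
proof -
  define below above left_proj where
    "below K \<longleftrightarrow> (\<exists>a \<in> carrier K - {\<one>\<^bsub>K\<^esub>}. a \<preceq>\<^bsub>K\<^esub> \<one>\<^bsub>K\<^esub>)" and
    "above K \<longleftrightarrow> (\<exists>a \<in> carrier K - {\<one>\<^bsub>K\<^esub>}. \<one>\<^bsub>K\<^esub> \<preceq>\<^bsub>K\<^esub> a)" and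
    "left_proj K \<longleftrightarrow> (\<forall>a \<in> carrier K - {\<one>\<^bsub>K\<^esub>}. \<forall>b \<in> carrier K - {\<one>\<^bsub>K\<^esub>}. a \<otimes>\<^bsub>K\<^esub> b = a)"
    for K :: "int omonoid"
  define L' where "L' = carrier L - {\<one>\<^bsub>L\<^esub>}"
  have "below K \<longleftrightarrow> (\<exists>a \<in> L'. a \<preceq>\<^bsub>L\<^esub> \<one>\<^bsub>L\<^esub>)" "above K \<longleftrightarrow> (\<exists>a \<in> L'. \<one>\<^bsub>L\<^esub> \<preceq>\<^bsub>L\<^esub> a)"
    "left_proj K \<longleftrightarrow> (\<forall>a \<in> L'. \<forall>b \<in> L'. a \<otimes>\<^bsub>L\<^esub> b = a)"
    if iso: "L \<cong>\<^sub>o K" for K :: "int omonoid"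
  proof -
    obtain f where f: "f \<in> omonoid_iso L K"
      using iso by (auto simp: omonoid_isomorphic_def)
    note f' = omonoid_isoD[OF f]
    have inj: "f a = f b \<longleftrightarrow> a = b" if "a \<in> carrier L" "b \<in> carrier L" for a b
      using f'(1) that by (auto simp: bij_betw_def inj_on_def)
    have img: "carrier K - {\<one>\<^bsub>K\<^esub>} = f ` L'"
      using f'(1) inj one unfolding f'(2)[symmetric] L'_def by (auto simp: bij_betw_def)
    show "below K \<longleftrightarrow> (\<exists>a \<in> L'. a \<preceq>\<^bsub>L\<^esub> \<one>\<^bsub>L\<^esub>)" "above K \<longleftrightarrow> (\<exists>a \<in> L'. \<one>\<^bsub>L\<^esub> \<preceq>\<^bsub>L\<^esub> a)"
      unfolding below_def above_def img using f'(4) one by (auto simp: L'_def simp flip: f'(2))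
    show "left_proj K \<longleftrightarrow> (\<forall>a \<in> L'. \<forall>b \<in> L'. a \<otimes>\<^bsub>L\<^esub> b = a)"
      unfolding left_proj_def img using inj closed by (auto simp: L'_def simp flip: f'(3))
  qed
  then have "below K \<longleftrightarrow> below K'" "above K \<longleftrightarrow> above K'" "left_proj K \<longleftrightarrow> left_proj K'"
    using K(2) K'(2) by simp_all
  moreover have "below C2" "\<not> above C2" "\<not> below C2_dual" "above C2_dual" "below G3" "above G3"
      "left_proj G3" "below D3" "above D3" "\<not> left_proj D3"
    by (simp_all add: below_def above_def left_proj_def C2_def C2_dual_def G3_def D3_def insert_Diff_if)
  ultimately show ?thesis
    using K(1) K'(1) by auto
qed

section \<open>Splitting off the first summand of a nested sum\<close>

lemma nested_sum_simps:
  "carrier (K \<boxplus> N) = nested_left K N ` carrier K \<union> Inr ` carrier N"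
  "mult (K \<boxplus> N) = nested_mult K N"
  "one (K \<boxplus> N) = Inr \<one>\<^bsub>N\<^esub>"
  "leq (K \<boxplus> N) = nested_leq K N"
  by (simp_all add: nested_sum_def)

lemma nested_left_eq_iff: "nested_left K N a = nested_left K N b \<longleftrightarrow> a = b"
  by (auto simp: nested_left_def)

lemma nested_left_eq_Inr_iff: "nested_left K N a = Inr b \<longleftrightarrow> a = \<one>\<^bsub>K\<^esub> \<and> b = \<one>\<^bsub>N\<^esub>"
  by (auto simp: nested_left_def)

lemma nested_left_eq_Inl_iff: "nested_left K N a = Inl b \<longleftrightarrow> a = b \<and> b \<noteq> \<one>\<^bsub>K\<^esub>"
  by (auto simp: nested_left_def)

lemma nested_left_image:
  assumes "\<one>\<^bsub>K\<^esub> \<in> carrier K"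
  shows "nested_left K N ` carrier K = insert (Inr \<one>\<^bsub>N\<^esub>) (Inl ` (carrier K - {\<one>\<^bsub>K\<^esub>}))"
  using assms by (auto simp: nested_left_def)

lemma nested_leq_left_iff:
  assumes "\<one>\<^bsub>K\<^esub> \<preceq>\<^bsub>K\<^esub> \<one>\<^bsub>K\<^esub>" "a \<in> carrier K" "b \<in> carrier K"
  shows "nested_leq K N (nested_left K N a) (nested_left K N b) \<longleftrightarrow> a \<preceq>\<^bsub>K\<^esub> b"
proof
  assume "nested_leq K N (nested_left K N a) (nested_left K N b)"
  then show "a \<preceq>\<^bsub>K\<^esub> b"
    by cases (use assms in \<open>auto simp: nested_left_eq_iff nested_left_eq_Inr_iff
      nested_left_eq_Inl_iff\<close>)
qed (use assms in \<open>auto intro: nested_leq.left\<close>)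

lemma nested_leq_right_iff:
  assumes "\<one>\<^bsub>N\<^esub> \<preceq>\<^bsub>N\<^esub> \<one>\<^bsub>N\<^esub>" "a \<in> carrier N" "b \<in> carrier N"
  shows "nested_leq K N (Inr a) (Inr b) \<longleftrightarrow> a \<preceq>\<^bsub>N\<^esub> b"
proof
  assume "nested_leq K N (Inr a) (Inr b)"
  then show "a \<preceq>\<^bsub>N\<^esub> b"
    by cases (use assms in \<open>auto simp: nested_left_eq_Inr_iff dest!: sym[of "Inr _"]\<close>)
qed (use assms in \<open>auto intro: nested_leq.right\<close>)

lemma nested_leq_Inl_Inr_iff:
  assumes "a \<in> carrier K - {\<one>\<^bsub>K\<^esub>}" "b \<in> carrier N"
  shows "nested_leq K N (Inl a) (Inr b) \<longleftrightarrow> a \<preceq>\<^bsub>K\<^esub> \<one>\<^bsub>K\<^esub>"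
proof
  assume "nested_leq K N (Inl a) (Inr b)"
  then show "a \<preceq>\<^bsub>K\<^esub> \<one>\<^bsub>K\<^esub>"
  proof cases
    case (left c d)
    then have "c = a" "d = \<one>\<^bsub>K\<^esub>"
      using nested_left_eq_Inl_iff[of K N c a] nested_left_eq_Inr_iff[of K N d b] by metis+
    then show ?thesis
      using left by simp
  qed auto
qed (use assms in \<open>auto intro: nested_leq.below\<close>)

lemma nested_leq_Inr_Inl_iff:
  assumes "a \<in> carrier K - {\<one>\<^bsub>K\<^esub>}" "b \<in> carrier N"
  shows "nested_leq K N (Inr b) (Inl a) \<longleftrightarrow> \<one>\<^bsub>K\<^esub> \<preceq>\<^bsub>K\<^esub> a"
proof
  assume "nested_leq K N (Inr b) (Inl a)"
  then show "\<one>\<^bsub>K\<^esub> \<preceq>\<^bsub>K\<^esub> a"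
  proof cases
    case (left c d)
    then have "d = a" "c = \<one>\<^bsub>K\<^esub>"
      using nested_left_eq_Inl_iff[of K N d a] nested_left_eq_Inr_iff[of K N c b] by metis+
    then show ?thesis
      using left by simp
  qed auto
qed (use assms in \<open>auto intro: nested_leq.above\<close>)

text \<open>
  An isomorphism sends minimal ideal to minimal ideal, and the minimal ideal of \<open>K \<boxplus> N\<close> consists
  of the non-identity elements of \<open>K\<close>: for these \<open>a \<otimes> b \<otimes> a = a\<close> holds by hypothesis when
  \<open>b \<in> K\<close> and by absorption when \<open>b \<in> N\<close>, while \<open>b \<otimes> a \<otimes> b = a \<noteq> b\<close> for \<open>b \<in> N\<close>.
\<close>
lemma iso_nested_sum_image_minimal_ideal:
  assumes M: "monoid M" and f: "f \<in> omonoid_iso M (K \<boxplus> N)"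
    and idem: "\<And>a. a \<in> carrier K - {\<one>\<^bsub>K\<^esub>} \<Longrightarrow> a \<otimes>\<^bsub>K\<^esub> a = a"
    and sandwich: "\<And>a b. \<lbrakk>a \<in> carrier K - {\<one>\<^bsub>K\<^esub>}; b \<in> carrier K - {\<one>\<^bsub>K\<^esub>}\<rbrakk>
      \<Longrightarrow> a \<otimes>\<^bsub>K\<^esub> b \<noteq> \<one>\<^bsub>K\<^esub> \<and> a \<otimes>\<^bsub>K\<^esub> b \<otimes>\<^bsub>K\<^esub> a = a"
    and nontrivial: "carrier K - {\<one>\<^bsub>K\<^esub>} \<noteq> {}"
    and x: "x \<in> carrier M"
  shows "x \<in> minimal_ideal M \<longleftrightarrow> f x \<in> Inl ` (carrier K - {\<one>\<^bsub>K\<^esub>})"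
proof -
  note f' = omonoid_isoD[OF f]
  have f_in: "f y \<in> carrier (K \<boxplus> N)" if "y \<in> carrier M" for y
    using f'(1) that by (auto simp: bij_betw_def)
  have inj: "f a = f b \<longleftrightarrow> a = b" if "a \<in> carrier M" "b \<in> carrier M" for a b
    using f'(1) that by (auto simp: bij_betw_def inj_on_def)
  have closed: "a \<otimes>\<^bsub>M\<^esub> b \<in> carrier M" if "a \<in> carrier M" "b \<in> carrier M" for a b
    using M that by (rule monoid.m_closed)
  have "x \<in> minimal_ideal M \<longleftrightarrow>
    (\<forall>y \<in> carrier M. f x \<otimes>\<^bsub>K \<boxplus> N\<^esub> f y \<otimes>\<^bsub>K \<boxplus> N\<^esub> f x = f x)"
    using x closed inj by (simp add: minimal_ideal_def flip: f'(3))
  also have "\<dots> \<longleftrightarrow> (\<forall>z \<in> carrier (K \<boxplus> N). f x \<otimes>\<^bsub>K \<boxplus> N\<^esub> z \<otimes>\<^bsub>K \<boxplus> N\<^esub> f x = f x)"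
    unfolding bij_betw_imp_surj_on[OF f'(1), symmetric] by simp
  also have "\<dots> \<longleftrightarrow> f x \<in> Inl ` (carrier K - {\<one>\<^bsub>K\<^esub>})"
  proof (cases "f x")
    case (Inl a)
    then have a: "a \<in> carrier K - {\<one>\<^bsub>K\<^esub>}"
      using f_in[OF x] by (auto simp: nested_sum_simps nested_left_def split: if_splits)
    have "Inl a \<otimes>\<^bsub>K \<boxplus> N\<^esub> z \<otimes>\<^bsub>K \<boxplus> N\<^esub> Inl a = Inl a" if "z \<in> carrier (K \<boxplus> N)" for z
      using that idem[OF a] sandwich[OF a] a
      by (auto simp: nested_sum_simps nested_left_def split: if_splits)
    then show ?thesis
      using Inl a by auto
  next
    case (Inr b)
    obtain a where a: "a \<in> carrier K - {\<one>\<^bsub>K\<^esub>}"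
      using nontrivial by auto
    then have "Inl a \<in> carrier (K \<boxplus> N)"
      by (auto simp: nested_sum_simps nested_left_def image_iff)
    moreover have "Inr b \<otimes>\<^bsub>K \<boxplus> N\<^esub> Inl a \<otimes>\<^bsub>K \<boxplus> N\<^esub> Inr b \<noteq> Inr b"
      by (simp add: nested_sum_simps)
    ultimately show ?thesis
      using Inr by auto
  qed
  finally show ?thesis .
qed

text \<open>
  The two given isomorphisms are glued. Products and comparisons inside one of the two parts are
  preserved by hypothesis. Those between \<open>s\<close> in the minimal ideal and \<open>x\<close> outside it are computed
  by absorption and by the side of \<open>\<one>\<close> on which \<open>s\<close> lies, which is the rule that defines the nested
  sum.
\<close>
lemma isomorphic_nested_sum_intro:
  fixes M :: "('a, 'm) omonoid_scheme" (structure) and K :: "('b, 'k) omonoid_scheme"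
    and N :: "('c, 'n) omonoid_scheme"
  assumes M: "idempotent_ordered_monoid M" and nontrivial: "carrier M \<noteq> {\<one>\<^bsub>M\<^esub>}"
    and K: "outer_layer M \<cong>\<^sub>o K" and N: "inner_part M \<cong>\<^sub>o N"
  shows "M \<cong>\<^sub>o K \<boxplus> N"
proof -
  interpret idempotent_ordered_monoid M by fact
  let ?I = "minimal_ideal M"
  obtain g h where "g \<in> omonoid_iso (outer_layer M) K" "h \<in> omonoid_iso (inner_part M) N"
    using K N by (auto simp: omonoid_isomorphic_def)
  note g = omonoid_isoD[OF this(1), simplified] and h = omonoid_isoD[OF this(2), simplified]
  have no_one: "\<one> \<notin> ?I"
    using nontrivial one_in_minimal_ideal_iff by simp
  have I: "?I \<subseteq> carrier M"
    by (rule minimal_ideal_subset)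
  have g_inj: "g a = g b \<longleftrightarrow> a = b" if "a \<in> insert \<one> ?I" "b \<in> insert \<one> ?I" for a b
    using g(1) that unfolding bij_betw_def inj_on_def by blast
  have g_one: "g a \<noteq> \<one>\<^bsub>K\<^esub>" if "a \<in> ?I" for a
    using g_inj[of a \<one>] g(2) that no_one by auto
  have g_img: "g ` ?I = carrier K - {\<one>\<^bsub>K\<^esub>}" "\<one>\<^bsub>K\<^esub> \<in> carrier K"
    using g(1,2) g_one by (auto simp: bij_betw_def)
  have h_inj: "inj_on h (carrier M - ?I)" and h_img: "h ` (carrier M - ?I) = carrier N"
    using h(1) by (auto simp: bij_betw_def)
  have h_one: "\<one>\<^bsub>N\<^esub> \<in> carrier N"
    using h_img h(2) no_one by force
  define f where "f x = (if x \<in> ?I then Inl (g x) else Inr (h x))" for x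
  have left: "f x = nested_left K N (g x)" if "x \<in> insert \<one> ?I" for x
    using that g_one g(2) h(2) no_one by (auto simp: f_def nested_left_def)
  have "f \<in> omonoid_iso M (K \<boxplus> N)"
  proof (rule omonoid_isoI)
    have "inj_on f (carrier M)"
      using g_inj h_inj by (auto simp: inj_on_def f_def split: if_splits)
    moreover have "f ` carrier M = f ` ?I \<union> f ` (carrier M - ?I)"
      using I by blast
    moreover have "f ` ?I = Inl ` (carrier K - {\<one>\<^bsub>K\<^esub>})"
      unfolding g_img(1)[symmetric] image_image by (rule image_cong) (simp_all add: f_def)
    moreover have "f ` (carrier M - ?I) = Inr ` carrier N"
      unfolding h_img[symmetric] image_image by (rule image_cong) (simp_all add: f_def)
    ultimately show "bij_betw f (carrier M) (carrier (K \<boxplus> N))"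
      using h_one g_img(2) by (auto simp: bij_betw_def nested_sum_simps nested_left_image)
    show "f \<one> = \<one>\<^bsub>K \<boxplus> N\<^esub>"
      using no_one h(2) by (simp add: f_def nested_sum_simps)
  next
    fix a b assume ab: "a \<in> carrier M" "b \<in> carrier M"
    show "f (a \<otimes> b) = f a \<otimes>\<^bsub>K \<boxplus> N\<^esub> f b"
    proof (cases "a \<in> ?I"; cases "b \<in> ?I")
      assume "a \<in> ?I" "b \<in> ?I"
      then show ?thesis
        using left[of "a \<otimes> b"] g(3)[of a b] minimal_ideal_is_ideal(1)[of a b] ab
        by (simp add: f_def nested_sum_simps)
    next
      assume "a \<notin> ?I" "b \<notin> ?I"
      then show ?thesis
        using h(3)[of a b] mult_conservative[OF ab] ab
        by (auto simp: f_def nested_sum_simps)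
    qed (use ab minimal_ideal_absorbs in \<open>auto simp: f_def nested_sum_simps\<close>)
    have "\<one> \<preceq> \<one>"
      by (simp add: refl_leq)
    then have refl1: "\<one>\<^bsub>K\<^esub> \<preceq>\<^bsub>K\<^esub> \<one>\<^bsub>K\<^esub>" "\<one>\<^bsub>N\<^esub> \<preceq>\<^bsub>N\<^esub> \<one>\<^bsub>N\<^esub>"
      using g(2) g(4)[of \<one> \<one>] h(2) h(4)[of \<one> \<one>] no_one by auto
    have mixed: "(s \<preceq> x \<longleftrightarrow> f s \<preceq>\<^bsub>K \<boxplus> N\<^esub> f x) \<and> (x \<preceq> s \<longleftrightarrow> f x \<preceq>\<^bsub>K \<boxplus> N\<^esub> f s)"
      if s: "s \<in> ?I" and x: "x \<in> carrier M" "x \<notin> ?I" for s x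
    proof -
      have sc: "s \<in> carrier M" "s \<noteq> \<one>" "s \<noteq> x"
        using s x no_one minimal_idealD(2) by auto
      have gs: "g s \<in> carrier K - {\<one>\<^bsub>K\<^esub>}" and hx: "h x \<in> carrier N"
        using g_img h_img s x by auto
      have gs_le: "g s \<preceq>\<^bsub>K\<^esub> \<one>\<^bsub>K\<^esub> \<longleftrightarrow> s \<preceq> \<one>" "\<one>\<^bsub>K\<^esub> \<preceq>\<^bsub>K\<^esub> g s \<longleftrightarrow> \<one> \<preceq> s"
        using g(4)[of s \<one>] g(4)[of \<one> s] g(2) s by auto
      have "nested_leq K N (Inl (g s)) (Inr (h x)) \<longleftrightarrow> g s \<preceq>\<^bsub>K\<^esub> \<one>\<^bsub>K\<^esub>"
        by (rule nested_leq_Inl_Inr_iff[OF gs hx])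
      moreover have "nested_leq K N (Inr (h x)) (Inl (g s)) \<longleftrightarrow> \<one>\<^bsub>K\<^esub> \<preceq>\<^bsub>K\<^esub> g s"
        by (rule nested_leq_Inr_Inl_iff[OF gs hx])
      moreover have "s \<preceq> x \<longleftrightarrow> s \<preceq> \<one>" "x \<preceq> s \<longleftrightarrow> \<one> \<preceq> s"
        by (rule minimal_ideal_leq_iff[OF s x])+
      ultimately show ?thesis
        using s x gs_le by (simp add: f_def nested_sum_simps)
    qed
    show "a \<preceq> b \<longleftrightarrow> f a \<preceq>\<^bsub>K \<boxplus> N\<^esub> f b"
    proof (cases "a \<in> ?I"; cases "b \<in> ?I")
      assume ab': "a \<in> ?I" "b \<in> ?I"
      then show ?thesis
        using left[of a] left[of b] g(4)[of a b] g_img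
          nested_leq_left_iff[OF refl1(1), of "g a" "g b"]
        by (auto simp: nested_sum_simps)
    next
      assume "a \<notin> ?I" "b \<notin> ?I"
      then show ?thesis
        using h(4)[of a b] h_img ab nested_leq_right_iff[OF refl1(2), of "h a" "h b"]
        by (auto simp: f_def nested_sum_simps)
    qed (use mixed ab in auto)
  qed
  then show ?thesis
    by (auto simp: omonoid_isomorphic_def)
qed

text \<open>
  The isomorphism maps the minimal ideal onto the non-identity elements of \<open>K\<close> and its complement
  onto \<open>N\<close>, so its restrictions are the two isomorphisms. In the sum the identity of \<open>N\<close>
  doubles as that of \<open>K\<close>, so products and comparisons of it with itself could come from either
  summand. The hypotheses on the two identities make both readings agree.
\<close>
lemma isomorphic_nested_sum_elim:
  fixes M :: "('a, 'm) omonoid_scheme" (structure) and K :: "('b, 'k) omonoid_scheme"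
    and N :: "('c, 'n) omonoid_scheme"
  assumes M: "idempotent_ordered_monoid M" and iso: "M \<cong>\<^sub>o K \<boxplus> N"
    and K: "\<one>\<^bsub>K\<^esub> \<in> carrier K" "\<one>\<^bsub>K\<^esub> \<preceq>\<^bsub>K\<^esub> \<one>\<^bsub>K\<^esub>"
    and K_one: "\<And>a. a \<in> carrier K \<Longrightarrow> \<one>\<^bsub>K\<^esub> \<otimes>\<^bsub>K\<^esub> a = a \<and> a \<otimes>\<^bsub>K\<^esub> \<one>\<^bsub>K\<^esub> = a"
    and N: "\<one>\<^bsub>N\<^esub> \<in> carrier N" "\<one>\<^bsub>N\<^esub> \<preceq>\<^bsub>N\<^esub> \<one>\<^bsub>N\<^esub>" "\<one>\<^bsub>N\<^esub> \<otimes>\<^bsub>N\<^esub> \<one>\<^bsub>N\<^esub> = \<one>\<^bsub>N\<^esub>"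
    and idem_K: "\<And>a. a \<in> carrier K - {\<one>\<^bsub>K\<^esub>} \<Longrightarrow> a \<otimes>\<^bsub>K\<^esub> a = a"
    and sandwich: "\<And>a b. \<lbrakk>a \<in> carrier K - {\<one>\<^bsub>K\<^esub>}; b \<in> carrier K - {\<one>\<^bsub>K\<^esub>}\<rbrakk>
      \<Longrightarrow> a \<otimes>\<^bsub>K\<^esub> b \<noteq> \<one>\<^bsub>K\<^esub> \<and> a \<otimes>\<^bsub>K\<^esub> b \<otimes>\<^bsub>K\<^esub> a = a"
    and nontrivial: "carrier K - {\<one>\<^bsub>K\<^esub>} \<noteq> {}"
  shows "carrier M \<noteq> {\<one>\<^bsub>M\<^esub>}" and "outer_layer M \<cong>\<^sub>o K" and "inner_part M \<cong>\<^sub>o N"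
proof -
  interpret idempotent_ordered_monoid M by fact
  let ?I = "minimal_ideal M"
  obtain f where f: "f \<in> omonoid_iso M (K \<boxplus> N)"
    using iso by (auto simp: omonoid_isomorphic_def)
  note f' = omonoid_isoD[OF f]
  have f_in: "f y \<in> carrier (K \<boxplus> N)" if "y \<in> carrier M" for y
    using f'(1) that by (auto simp: bij_betw_def)
  have inj: "f a = f b \<longleftrightarrow> a = b" if "a \<in> carrier M" "b \<in> carrier M" for a b
    using f'(1) that by (auto simp: bij_betw_def inj_on_def)
  have surj: "\<exists>x \<in> carrier M. f x = z" if "z \<in> carrier (K \<boxplus> N)" for z
    using bij_betw_imp_surj_on[OF f'(1)] that by (metis imageE)
  have ideal: "x \<in> ?I \<longleftrightarrow> f x \<in> Inl ` (carrier K - {\<one>\<^bsub>K\<^esub>})" if "x \<in> carrier M" for x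
    using iso_nested_sum_image_minimal_ideal[OF monoid_axioms f idem_K sandwich nontrivial that] .
  have f_one: "f \<one> = Inr \<one>\<^bsub>N\<^esub>"
    using f'(2) by (simp add: nested_sum_simps)
  have no_one: "\<one> \<notin> ?I"
    using ideal[OF one_closed] f_one by auto
  then show "carrier M \<noteq> {\<one>}"
    using one_in_minimal_ideal_iff by simp
  have I: "?I \<subseteq> carrier M"
    by (rule minimal_ideal_subset)

  define p where "p x = (case f x of Inl a \<Rightarrow> a | Inr _ \<Rightarrow> \<one>\<^bsub>K\<^esub>)" for x
  have p: "p x \<in> carrier K" "f x = nested_left K N (p x)" if "x \<in> insert \<one> ?I" for x
  proof -
    have "x \<in> carrier M"
      using that I by auto
    then show "p x \<in> carrier K" "f x = nested_left K N (p x)"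
      using that ideal[of x] f_one K(1) by (auto simp: p_def nested_left_def)
  qed
  have left_mult: "nested_left K N (a \<otimes>\<^bsub>K\<^esub> b) = nested_left K N a \<otimes>\<^bsub>K \<boxplus> N\<^esub> nested_left K N b"
    if "a \<in> carrier K" "b \<in> carrier K" for a b
    using that K_one[of a] K_one[of b] N(3) by (auto simp: nested_left_def nested_sum_simps)
  have "p \<in> omonoid_iso (outer_layer M) K"
  proof (rule omonoid_isoI)
    have "inj_on p (insert \<one> ?I)"
      using p(2) inj I by (intro inj_onI) (metis insert_iff one_closed subsetD)
    moreover have "a \<in> p ` insert \<one> ?I" if a: "a \<in> carrier K" for a
    proof (cases "a = \<one>\<^bsub>K\<^esub>")
      case True
      then show ?thesis
        using f_one by (auto simp: p_def)
    next
      case False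
      then have "Inl a \<in> carrier (K \<boxplus> N)"
        using a by (auto simp: nested_sum_simps nested_left_def image_iff)
      then obtain x where "x \<in> carrier M" "f x = Inl a"
        using surj by blast
      then show ?thesis
        using ideal[of x] a False by (force simp: p_def)
    qed
    ultimately show "bij_betw p (carrier (outer_layer M)) (carrier K)"
      using p(1) by (auto simp: bij_betw_def)
    show "p \<one>\<^bsub>outer_layer M\<^esub> = \<one>\<^bsub>K\<^esub>"
      using f_one by (simp add: p_def)
  next
    fix a b assume "a \<in> carrier (outer_layer M)" "b \<in> carrier (outer_layer M)"
    then have ab: "a \<in> insert \<one> ?I" "b \<in> insert \<one> ?I"
      by auto
    then have c: "a \<in> carrier M" "b \<in> carrier M" "a \<otimes> b \<in> insert \<one> ?I"
      using I minimal_ideal_is_ideal by auto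
    have "nested_left K N (p (a \<otimes> b)) = nested_left K N (p a \<otimes>\<^bsub>K\<^esub> p b)"
      using p[OF ab(1)] p[OF ab(2)] p(2)[OF c(3)] f'(3)[OF c(1,2)] left_mult by simp
    then show "p (a \<otimes>\<^bsub>outer_layer M\<^esub> b) = p a \<otimes>\<^bsub>K\<^esub> p b"
      by (simp add: nested_left_eq_iff)
    show "a \<preceq>\<^bsub>outer_layer M\<^esub> b \<longleftrightarrow> p a \<preceq>\<^bsub>K\<^esub> p b"
      using f'(4)[OF c(1,2)] p[OF ab(1)] p[OF ab(2)] nested_leq_left_iff[OF K(2)]
      by (simp add: nested_sum_simps)
  qed
  then show "outer_layer M \<cong>\<^sub>o K"
    by (auto simp: omonoid_isomorphic_def)

  define q where "q x = projr (f x)" for x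
  have q: "q x \<in> carrier N" "f x = Inr (q x)" if "x \<in> carrier M - ?I" for x
    using that ideal[of x] f_in[of x] N(1)
    by (auto simp: q_def nested_sum_simps nested_left_def split: if_splits)
  have "q \<in> omonoid_iso (inner_part M) N"
  proof (rule omonoid_isoI)
    have "inj_on q (carrier M - ?I)"
      using q(2) inj by (intro inj_onI) (metis DiffD1)
    moreover have "b \<in> q ` (carrier M - ?I)" if b: "b \<in> carrier N" for b
    proof -
      obtain x where "x \<in> carrier M" "f x = Inr b"
        using surj[of "Inr b"] b by (auto simp: nested_sum_simps)
      then show ?thesis
        using ideal[of x] by (force simp: q_def)
    qed
    ultimately show "bij_betw q (carrier (inner_part M)) (carrier N)"
      using q(1) by (auto simp: bij_betw_def)
    show "q \<one>\<^bsub>inner_part M\<^esub> = \<one>\<^bsub>N\<^esub>"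
      using f_one by (simp add: q_def)
  next
    fix a b assume "a \<in> carrier (inner_part M)" "b \<in> carrier (inner_part M)"
    then have ab: "a \<in> carrier M - ?I" "b \<in> carrier M - ?I"
      by auto
    then have c: "a \<in> carrier M" "b \<in> carrier M" "a \<otimes> b \<in> carrier M - ?I"
      using mult_conservative[of a b] by auto
    show "q (a \<otimes>\<^bsub>inner_part M\<^esub> b) = q a \<otimes>\<^bsub>N\<^esub> q b"
      using q(2)[OF ab(1)] q(2)[OF ab(2)] q(2)[OF c(3)] f'(3)[OF c(1,2)]
      by (simp add: nested_sum_simps)
    show "a \<preceq>\<^bsub>inner_part M\<^esub> b \<longleftrightarrow> q a \<preceq>\<^bsub>N\<^esub> q b"
      using f'(4)[OF c(1,2)] q[OF ab(1)] q[OF ab(2)] nested_leq_right_iff[OF N(2)]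
      by (simp add: nested_sum_simps)
  qed
  then show "inner_part M \<cong>\<^sub>o N"
    by (auto simp: omonoid_isomorphic_def)
qed

lemma isomorphic_nested_sum_iff:
  assumes "idempotent_ordered_monoid M" and "K \<in> {C2, C2_dual, G3, D3}"
    and "\<one>\<^bsub>N\<^esub> \<in> carrier N" "\<one>\<^bsub>N\<^esub> \<preceq>\<^bsub>N\<^esub> \<one>\<^bsub>N\<^esub>" "\<one>\<^bsub>N\<^esub> \<otimes>\<^bsub>N\<^esub> \<one>\<^bsub>N\<^esub> = \<one>\<^bsub>N\<^esub>"
  shows "M \<cong>\<^sub>o K \<boxplus> N \<longleftrightarrow> carrier M \<noteq> {\<one>\<^bsub>M\<^esub>} \<and> outer_layer M \<cong>\<^sub>o K \<and> inner_part M \<cong>\<^sub>o N"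
proof
  assume iso: "M \<cong>\<^sub>o K \<boxplus> N"
  show "carrier M \<noteq> {\<one>\<^bsub>M\<^esub>} \<and> outer_layer M \<cong>\<^sub>o K \<and> inner_part M \<cong>\<^sub>o N"
    by (intro conjI; rule isomorphic_nested_sum_elim[OF assms(1) iso])
      (use assms in \<open>auto simp: C2_def C2_dual_def G3_def D3_def\<close>)
next
  assume "carrier M \<noteq> {\<one>\<^bsub>M\<^esub>} \<and> outer_layer M \<cong>\<^sub>o K \<and> inner_part M \<cong>\<^sub>o N"
  then show "M \<cong>\<^sub>o K \<boxplus> N"
    using isomorphic_nested_sum_intro assms(1) by blast
qed

section \<open>Existence and uniqueness of the decomposition\<close>

lemma nested_sum_list_one:
  fixes Ms :: "int omonoid list"
  defines "N \<equiv> nested_sum_list Ms"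
  shows "\<one>\<^bsub>N\<^esub> \<in> carrier N" and "\<one>\<^bsub>N\<^esub> \<preceq>\<^bsub>N\<^esub> \<one>\<^bsub>N\<^esub>" and "\<one>\<^bsub>N\<^esub> \<otimes>\<^bsub>N\<^esub> \<one>\<^bsub>N\<^esub> = \<one>\<^bsub>N\<^esub>"
proof -
  have "\<one>\<^bsub>N\<^esub> \<in> carrier N \<and> \<one>\<^bsub>N\<^esub> \<preceq>\<^bsub>N\<^esub> \<one>\<^bsub>N\<^esub> \<and> \<one>\<^bsub>N\<^esub> \<otimes>\<^bsub>N\<^esub> \<one>\<^bsub>N\<^esub> = \<one>\<^bsub>N\<^esub>"
    unfolding N_def
  proof (induction Ms)
    case Nil
    show ?case
      by (simp add: trivial_omonoid_def)
  next
    case (Cons K Ms)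
    let ?S = "K \<boxplus> nested_sum_list Ms"
    have "\<one>\<^bsub>?S\<^esub> \<in> carrier ?S"
      using Cons by (simp add: nested_sum_simps)
    then have "inv_into (carrier ?S) to_nat (to_nat \<one>\<^bsub>?S\<^esub>) = \<one>\<^bsub>?S\<^esub>"
      by (intro inv_into_f_f) (auto simp: inj_on_def)
    then show ?case
      using Cons by (auto simp: relabel_def Let_def nested_sum_simps intro: nested_leq.right)
  qed
  then show "\<one>\<^bsub>N\<^esub> \<in> carrier N" and "\<one>\<^bsub>N\<^esub> \<preceq>\<^bsub>N\<^esub> \<one>\<^bsub>N\<^esub>" and "\<one>\<^bsub>N\<^esub> \<otimes>\<^bsub>N\<^esub> \<one>\<^bsub>N\<^esub> = \<one>\<^bsub>N\<^esub>"
    by auto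
qed

lemma isomorphic_nested_sum_list_Nil_iff:
  assumes "idempotent_ordered_monoid M"
  shows "M \<cong>\<^sub>o nested_sum_list ([] :: int omonoid list) \<longleftrightarrow> carrier M = {\<one>\<^bsub>M\<^esub>}"
proof
  interpret idempotent_ordered_monoid M by fact
  show "carrier M = {\<one>\<^bsub>M\<^esub>}" if iso: "M \<cong>\<^sub>o nested_sum_list ([] :: int omonoid list)"
  proof -
    obtain f where "f \<in> omonoid_iso M (nested_sum_list ([] :: int omonoid list))"
      using iso by (auto simp: omonoid_isomorphic_def)
    from omonoid_isoD(1)[OF this] have f: "inj_on f (carrier M)" "f ` carrier M = {0}"
      by (auto simp: bij_betw_def trivial_omonoid_def)
    have zero: "f x = 0" if "x \<in> carrier M" for x
      using f(2) imageI[OF that, of f] by simp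
    have "x = \<one>\<^bsub>M\<^esub>" if "x \<in> carrier M" for x
      using zero[OF that] zero[OF one_closed] that by (intro inj_onD[OF f(1)]) simp_all
    then show ?thesis
      using one_closed by auto
  qed
  assume M: "carrier M = {\<one>\<^bsub>M\<^esub>}"
  have "(\<lambda>_. 0) \<in> omonoid_iso M (nested_sum_list ([] :: int omonoid list))"
    by (rule omonoid_isoI) (use M refl_leq in \<open>auto simp: bij_betw_def trivial_omonoid_def\<close>)
  then show "M \<cong>\<^sub>o nested_sum_list ([] :: int omonoid list)"
    by (auto simp: omonoid_isomorphic_def)
qed

lemma isomorphic_nested_sum_list_Cons_iff:
  assumes M: "idempotent_ordered_monoid M" and K: "K \<in> {C2, C2_dual, G3, D3}"
  shows "M \<cong>\<^sub>o nested_sum_list (K # Ms) \<longleftrightarrow>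
    carrier M \<noteq> {\<one>\<^bsub>M\<^esub>} \<and> outer_layer M \<cong>\<^sub>o K \<and> inner_part M \<cong>\<^sub>o nested_sum_list Ms"
proof -
  have "monoid M"
    using M by (simp add: idempotent_ordered_monoid_def ordered_monoid_def)
  then show ?thesis
    using isomorphic_nested_sum_iff[OF M K nested_sum_list_one] by (simp add: isomorphic_relabel_iff)
qed

theorem theorem3p7:
  fixes M :: "('a, 'm) omonoid_scheme"
  assumes "idempotent_ordered_monoid M"
    and "finite (carrier M)"
  shows "\<exists>!Ms. set Ms \<subseteq> {C2, C2_dual, G3, D3} \<and> M \<cong>\<^sub>o nested_sum_list Ms"
  using assms
proof (induction "card (carrier M)" arbitrary: M rule: less_induct)
  case less
  note M = less.prems(1) and fin = less.prems(2)
  interpret idempotent_ordered_monoid M by fact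
  note Nil_iff = isomorphic_nested_sum_list_Nil_iff[OF M]
    and Cons_iff = isomorphic_nested_sum_list_Cons_iff[OF M]
  show ?case
  proof (cases "carrier M = {\<one>\<^bsub>M\<^esub>}")
    case True
    show ?thesis
    proof (rule ex1I[of _ "[]"])
      show "set [] \<subseteq> {C2, C2_dual, G3, D3} \<and> M \<cong>\<^sub>o nested_sum_list ([] :: int omonoid list)"
        using True Nil_iff by simp
    next
      fix Ms assume "set Ms \<subseteq> {C2, C2_dual, G3, D3} \<and> M \<cong>\<^sub>o nested_sum_list Ms"
      then show "Ms = []"
        using True Cons_iff by (cases Ms) (auto simp del: nested_sum_list.simps)
    qed
  next
    case False
    obtain K where K: "K \<in> {C2, C2_dual, G3, D3}" "outer_layer M \<cong>\<^sub>o K"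
      using ex_outer_layer_isomorphic[OF fin False] by blast
    have "carrier M - minimal_ideal M \<subset> carrier M"
      using minimal_ideal_nonempty[OF fin] minimal_ideal_subset[of M] by blast
    then have "card (carrier (inner_part M)) < card (carrier M)"
      using fin by (simp add: psubset_card_mono)
    then have "\<exists>!Ms. set Ms \<subseteq> {C2, C2_dual, G3, D3} \<and> inner_part M \<cong>\<^sub>o nested_sum_list Ms"
      using less.hyps[of "inner_part M"] inner_part_idempotent_ordered_monoid[OF False] fin
      by simp
    then obtain Ms where Ms: "set Ms \<subseteq> {C2, C2_dual, G3, D3}" "inner_part M \<cong>\<^sub>o nested_sum_list Ms"
      and Ms_unique: "\<And>Ns. \<lbrakk>set Ns \<subseteq> {C2, C2_dual, G3, D3}; inner_part M \<cong>\<^sub>o nested_sum_list Ns\<rbrakk>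
        \<Longrightarrow> Ns = Ms"
      by blast
    show ?thesis
    proof (rule ex1I[of _ "K # Ms"])
      show "set (K # Ms) \<subseteq> {C2, C2_dual, G3, D3} \<and> M \<cong>\<^sub>o nested_sum_list (K # Ms)"
        using False K Ms Cons_iff[OF K(1)] by (simp del: nested_sum_list.simps)
    next
      fix Ns assume Ns: "set Ns \<subseteq> {C2, C2_dual, G3, D3} \<and> M \<cong>\<^sub>o nested_sum_list Ns"
      then obtain K' Ms' where eq: "Ns = K' # Ms'"
        using False Nil_iff by (cases Ns) (auto simp del: nested_sum_list.simps)
      then have K': "K' \<in> {C2, C2_dual, G3, D3}" and Ms': "set Ms' \<subseteq> {C2, C2_dual, G3, D3}"
        using Ns by auto
      then have iso: "outer_layer M \<cong>\<^sub>o K'" "inner_part M \<cong>\<^sub>o nested_sum_list Ms'"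
        using Ns eq Cons_iff[OF K'] by auto
      have "K' = K"
        by (rule isomorphic_four_algebras_unique[OF _ _ K' iso(1) K])
          (auto simp: minimal_idealD minimal_ideal_is_ideal)
      then show "Ns = K # Ms"
        using eq Ms_unique[OF Ms' iso(2)] by simp
    qed
  qed
qed

end
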